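(* Let $G$ be an undirected connected graph on the node set $\{1,\dots,n\}$, let $U\ge n$, let $x_1(1),\dots,x_n(1)$ be arbitrary real numbers, put $y_i(1)=x_i(1)$, and suppose that for all $t\ge 1$ every node $i$ updates $$y_i(t+1)=x_i(t)+\frac12\sum_{j\in N(i)}\frac{x_j(t)-x_i(t)}{\max(d(i),d(j))},$$ $$x_i(t+1)=y_i(t+1)+\left(1-\frac{2}{9U+1}\right)\left(y_i(t+1)-y_i(t)\right).$$ Then for all $t\ge 1$, $$\|\mathbf{y}(t)-\overline{x}\mathbf{1}\|_2^2\le 2\left(1-\frac{1}{9U}\right)^{t-1}\|\mathbf{y}(1)-\overline{x}\mathbf{1}\|_2^2 .$$
   Context: $N(i)$ is the set of neighbors of node $i$ in $G$ (with $i\notin N(i)$) and $d(i)$ is the degree of $i$. $\mathbf{y}(t)=(y_1(t),\dots,y_n(t))^T$, $\mathbf{1}$ is the all-ones vector in $\mathbb{R}^n$, and $\overline{x}=\frac1n\sum_{j=1}^n x_j(1)$ is the initial average. *)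

theory Defs
  imports "HOL-Analysis.Analysis" "Graph_Theory.Graph_Theory"
begin

text \<open>
  The node set \<open>{1,\<dots>,n}\<close> is a finite type \<open>'n\<close> with \<open>n = CARD('n)\<close>, and
  vectors of \<open>\<real>\<^sup>n\<close> have type \<open>real ^ 'n\<close>. The locale \<open>pair_graph\<close> stands for
  finite simple undirected graphs: arcs are ordered pairs, they are loop-free, and each
  undirected edge \<open>{i,j}\<close> is represented by both \<open>(i,j)\<close> and \<open>(j,i)\<close>.
\<close>

definition neighbors :: "'n pair_pre_digraph \<Rightarrow> 'n \<Rightarrow> 'n set"
  where "neighbors G i = {j. (i, j) \<in> parcs G}"

definition node_degree :: "'n pair_pre_digraph \<Rightarrow> 'n \<Rightarrow> nat"
  where "node_degree G i = card (neighbors G i)"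

text \<open>Time is indexed from 1, so the initial average is the mean of the entries of \<open>x 1\<close>.\<close>

definition initial_average :: "(nat \<Rightarrow> real ^ 'n) \<Rightarrow> real"
  where "initial_average x = (1 / real CARD('n)) * (\<Sum>j\<in>UNIV. x 1 $ j)"

definition all_ones :: "real ^ 'n"
  where "all_ones = (\<chi> i. 1)"

end

theory Submission
  imports Defs
begin

text \<open>
  Subtracting the initial average from both sequences turns the protocol into
  \<open>y' = x - L x\<close>, \<open>x' = y' + \<beta> (y' - y)\<close>, where \<open>L\<close> is half the graph Laplacian with the
  Metropolis weights \<open>1 / max (d i) (d j)\<close>. This is Nesterov's accelerated gradient method with
  unit step for the quadratic \<open>\<langle>v, L v\<rangle> / 2\<close>, and \<open>\<beta> = (1 - q) / (1 + q)\<close> with \<open>q = 1 / (9 U)\<close> is the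
  momentum suited to a quadratic whose nonzero eigenvalues lie in \<open>[q\<^sup>2, 1]\<close>.

  The usual Lyapunov function would bound \<open>\<langle>y, L y\<rangle>\<close>, and passing from it to
  the norm would cost a factor \<open>1 / q\<^sup>2\<close>. The vector \<open>y\<close> at time 1 has zero sum, hence lies in the range of
  \<open>L\<close>, and so the whole trajectory has the form \<open>y = L v\<close>, \<open>x = L u\<close>. Running the Lyapunov argument
  for the preimages gives the function
  \<open>\<parallel>L v\<parallel>\<^sup>2 + \<langle>r, L r\<rangle>\<close> with \<open>r = (1 + q) u - v\<close>, which bounds \<open>\<parallel>y\<parallel>\<^sup>2\<close>, contracts by \<open>1 - q\<close> in every step
  (\<open>accelerated_step_contracts\<close>), and is at most \<open>2 \<parallel>y\<parallel>\<^sup>2\<close> at the start: this is where the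
  factor 2 comes from.

  What is needed of \<open>L\<close> is \<open>q\<^sup>2 \<langle>v, L v\<rangle> \<le> \<parallel>L v\<parallel>\<^sup>2 \<le> \<langle>v, L v\<rangle>\<close>. The upper bound
  holds because the rows of Metropolis weights sum to at most 1. The lower one is a Poincare
  inequality with constant of order \<open>n\<^sup>2\<close> (\<open>metropolis_spectral_gap\<close>): two
  vertices are joined by a shortest walk, the resistance of an edge is the larger of its two
  degrees, and the degrees along a shortest walk add up to at most \<open>3 n\<close>, because a vertex can
  be adjacent to at most three vertices of such a walk. The resulting gap \<open>1 / (12 n\<^sup>2)\<close> exceeds
  \<open>q\<^sup>2 = 1 / (81 U\<^sup>2)\<close>.
\<close>

section \<open>Accelerated iteration of a self-adjoint operator\<close>

text \<open>
  On an eigenvector of \<open>L\<close> with eigenvalue \<open>\<lambda>\<close>, and with \<open>d = u - v\<close>, new value minus \<open>1 - q\<close>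
  times old value is \<open>- \<lambda>\<^sup>3 (1 - \<lambda>) u\<^sup>2 - q \<lambda> (\<lambda> - q\<^sup>2) u\<^sup>2 - (1 - q) \<lambda> (q + \<lambda>) d\<^sup>2\<close>: all
  cross terms \<open>u d\<close> cancel, thanks to the choice of the momentum, and the two remaining
  brackets are nonnegative for \<open>\<lambda>\<close> in \<open>[q\<^sup>2, 1]\<close>; for \<open>\<lambda> = 0\<close> everything vanishes. The proof writes the same identity in inner
  products, so that no diagonalisation is involved. On the left \<open>u - L u\<close> is the new \<open>v\<close>, and
  \<open>u - L u - (1 - q) v\<close> is what \<open>(1 + q) u - v\<close> becomes after the step.
\<close>

lemma accelerated_step_contracts:
  fixes L :: "'a::real_inner \<Rightarrow> 'a"
  assumes lin: "linear L"
    and sa: "\<And>u v. inner u (L v) = inner (L u) v"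
    and upper: "\<And>v. (norm (L v))\<^sup>2 \<le> inner v (L v)"
    and lower: "\<And>v. q\<^sup>2 * inner v (L v) \<le> (norm (L v))\<^sup>2"
    and q: "0 \<le> q" "q \<le> 1"
  shows "(norm (L (u - L u)))\<^sup>2 + inner (u - L u - (1 - q) *\<^sub>R v) (L (u - L u - (1 - q) *\<^sub>R v))
    \<le> (1 - q) * ((norm (L v))\<^sup>2 + inner ((1 + q) *\<^sub>R u - v) (L ((1 + q) *\<^sub>R u - v)))"
    (is "?new \<le> (1 - q) * ?old")
proof -
  note lins = linear_diff[OF lin] linear_scale[OF lin] linear_add[OF lin]
  define d where "d = u - v"
  define s where "s = inner (L u) (L (L u)) - (norm (L (L u)))\<^sup>2"
  define t where "t = (norm (L u))\<^sup>2 - q\<^sup>2 * inner u (L u)"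
  define r where "r = q * inner d (L d) + (norm (L d))\<^sup>2"
  have v: "v = u - d" by (simp add: d_def)
  \<comment> \<open>Moving every \<open>L\<close> to the right brings all inner products to a normal form.\<close>
  have move: "inner (L w) z = inner w (L z)" for w z by (rule sa[symmetric])
  have comm: "inner u (L d) = inner d (L u)" "inner u (L (L d)) = inner d (L (L u))"
    using move inner_commute by metis+
  have "?new - (1 - q) * ?old = - s - q * t - (1 - q) * r"
    unfolding s_def t_def r_def v power2_norm_eq_inner
    by (simp add: lins inner_simps move comm) (simp add: algebra_simps power2_eq_square)
  moreover have "0 \<le> s" using upper[of "L u"] by (simp add: s_def)
  moreover have "0 \<le> q * t" using lower[of u] q by (simp add: t_def)
  moreover have "0 \<le> inner d (L d)" by (rule order_trans[OF zero_le_power2 upper])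
  then have "0 \<le> r" using q by (simp add: r_def)
  moreover from this q have "0 \<le> (1 - q) * r" by simp
  ultimately show ?thesis by linarith
qed

text \<open>
  The preimages \<open>v\<close> and \<open>u\<close> follow the same recursion as \<open>y\<close> and \<open>x\<close>, started at
  \<open>v = u = w\<close>. There the Lyapunov function is \<open>\<parallel>L w\<parallel>\<^sup>2 + q\<^sup>2 \<langle>w, L w\<rangle>\<close>, at most twice
  \<open>\<parallel>L w\<parallel>\<^sup>2\<close> by the lower spectral bound.
\<close>

lemma accelerated_iteration_bound:
  fixes L :: "'a::real_inner \<Rightarrow> 'a" and x y :: "nat \<Rightarrow> 'a"
  assumes lin: "linear L"
    and sa: "\<And>u v. inner u (L v) = inner (L u) v"
    and upper: "\<And>v. (norm (L v))\<^sup>2 \<le> inner v (L v)"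
    and lower: "\<And>v. q\<^sup>2 * inner v (L v) \<le> (norm (L v))\<^sup>2"
    and q: "0 \<le> q" "q \<le> 1"
    and start: "y 0 = L w" "x 0 = y 0"
    and y_step: "\<And>t. y (Suc t) = x t - L (x t)"
    and x_step: "\<And>t. x (Suc t) = y (Suc t) + ((1 - q) / (1 + q)) *\<^sub>R (y (Suc t) - y t)"
  shows "(norm (y t))\<^sup>2 \<le> 2 * (1 - q) ^ t * (norm (y 0))\<^sup>2"
proof -
  note lins = linear_diff[OF lin] linear_scale[OF lin] linear_add[OF lin]
  have "\<exists>v u. y t = L v \<and> x t = L u \<and>
    (norm (L v))\<^sup>2 + inner ((1 + q) *\<^sub>R u - v) (L ((1 + q) *\<^sub>R u - v))
      \<le> (1 - q) ^ t * (2 * (norm (y 0))\<^sup>2)"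
  proof (induction t)
    case 0
    have "(1 + q) *\<^sub>R w - w = q *\<^sub>R w" by (simp add: algebra_simps)
    then show ?case
      using lower[of w] start
      by (intro exI[of _ w]) (simp add: lins power2_eq_square mult.assoc)
  next
    case (Suc t)
    then obtain v u where vu: "y t = L v" "x t = L u"
      and bound: "(norm (L v))\<^sup>2 + inner ((1 + q) *\<^sub>R u - v) (L ((1 + q) *\<^sub>R u - v))
      \<le> (1 - q) ^ t * (2 * (norm (y 0))\<^sup>2)" by blast
    define v' where "v' = u - L u"
    define u' where "u' = v' + ((1 - q) / (1 + q)) *\<^sub>R (v' - v)"
    have "(1 + q) *\<^sub>R u' = (1 + q) *\<^sub>R v' + (1 - q) *\<^sub>R (v' - v)"
      using q by (simp add: u'_def scaleR_right_distrib)
    then have eq: "(1 + q) *\<^sub>R u' - v' = u - L u - (1 - q) *\<^sub>R v"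
      by (simp add: v'_def algebra_simps)
    have "(norm (L v'))\<^sup>2 + inner ((1 + q) *\<^sub>R u' - v') (L ((1 + q) *\<^sub>R u' - v'))
      \<le> (1 - q) * ((1 - q) ^ t * (2 * (norm (y 0))\<^sup>2))"
      unfolding eq unfolding v'_def
      by (rule order_trans[OF accelerated_step_contracts[OF lin sa upper lower q]])
        (use bound q in \<open>auto intro: mult_left_mono\<close>)
    moreover have "y (Suc t) = L v'" by (simp add: y_step vu v'_def lins)
    moreover from this have "x (Suc t) = L u'" by (simp add: x_step vu u'_def lins)
    ultimately show ?case by (intro exI[of _ v'] exI[of _ u']) (simp add: mult.assoc)
  qed
  then obtain v u where "y t = L v" and
    "(norm (L v))\<^sup>2 + inner ((1 + q) *\<^sub>R u - v) (L ((1 + q) *\<^sub>R u - v))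
      \<le> (1 - q) ^ t * (2 * (norm (y 0))\<^sup>2)" by blast
  moreover have "0 \<le> inner ((1 + q) *\<^sub>R u - v) (L ((1 + q) *\<^sub>R u - v))"
    by (rule order_trans[OF zero_le_power2 upper])
  ultimately show ?thesis by simp
qed

section \<open>Weighted Laplacians\<close>

text \<open>
  The factor 1/2 is the laziness of the averaging step; it makes row sums of the weights up to 1
  suffice for \<open>L \<le> 1\<close>.
\<close>

definition weighted_laplacian :: "('n \<Rightarrow> 'n \<Rightarrow> real) \<Rightarrow> real ^ 'n::finite \<Rightarrow> real ^ 'n"
  where "weighted_laplacian c v = (\<chi> i. 1 / 2 * (\<Sum>j\<in>UNIV. c i j * (v $ i - v $ j)))"

text \<open>
  The sum runs over ordered pairs, so every edge counts twice and \<open>\<langle>v, L v\<rangle>\<close> is a quarter of it.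
\<close>

definition dirichlet_energy :: "('n \<Rightarrow> 'n \<Rightarrow> real) \<Rightarrow> real ^ 'n::finite \<Rightarrow> real"
  where "dirichlet_energy c v = (\<Sum>i\<in>UNIV. \<Sum>j\<in>UNIV. c i j * (v $ i - v $ j)\<^sup>2)"

lemma linear_weighted_laplacian: "linear (weighted_laplacian c)"
proof (rule linearI)
  show "weighted_laplacian c (u + v) = weighted_laplacian c u + weighted_laplacian c v" for u v
    by (simp add: weighted_laplacian_def vec_eq_iff sum.distrib[symmetric] ring_distribs[symmetric])
      (simp add: algebra_simps)
  show "weighted_laplacian c (r *\<^sub>R v) = r *\<^sub>R weighted_laplacian c v" for r v
    by (simp add: weighted_laplacian_def vec_eq_iff sum_distrib_left algebra_simps)
qed

lemma weighted_laplacian_all_ones: "weighted_laplacian c all_ones = 0"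
  by (simp add: weighted_laplacian_def all_ones_def vec_eq_iff)

text \<open>
  Summation by parts: exchanging the two summation indices and averaging the two expressions
  replaces \<open>u $ i\<close> by half the difference \<open>u $ i - u $ j\<close>.
\<close>

lemma inner_weighted_laplacian:
  assumes sym: "\<And>i j. c i j = c j i"
  shows "inner u (weighted_laplacian c v)
    = 1 / 4 * (\<Sum>i\<in>UNIV. \<Sum>j\<in>UNIV. c i j * (u $ i - u $ j) * (v $ i - v $ j))"
proof -
  define S where "S = (\<Sum>i\<in>UNIV. \<Sum>j\<in>UNIV. c i j * u $ i * (v $ i - v $ j))"
  have "S = (\<Sum>j\<in>UNIV. \<Sum>i\<in>UNIV. c i j * u $ i * (v $ i - v $ j))"
    unfolding S_def by (rule sum.swap)
  also have "\<dots> = - (\<Sum>i\<in>UNIV. \<Sum>j\<in>UNIV. c i j * u $ j * (v $ i - v $ j))"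
    unfolding sum_negf[symmetric] by (intro sum.cong refl) (subst sym, simp add: algebra_simps)
  finally have "2 * S = (\<Sum>i\<in>UNIV. \<Sum>j\<in>UNIV. c i j * (u $ i - u $ j) * (v $ i - v $ j))"
    unfolding S_def by (simp add: sum_subtractf algebra_simps sum.distrib)
  moreover have "inner u (weighted_laplacian c v) = 1 / 2 * S"
    by (simp add: weighted_laplacian_def inner_vec_def S_def sum_distrib_left sum_divide_distrib algebra_simps)
  ultimately show ?thesis by simp
qed

lemma inner_weighted_laplacian_self:
  assumes "\<And>i j. c i j = c j i"
  shows "inner v (weighted_laplacian c v) = 1 / 4 * dirichlet_energy c v"
  using inner_weighted_laplacian[of c, OF assms]
  by (simp add: dirichlet_energy_def power2_eq_square mult.assoc)

lemma weighted_laplacian_self_adjoint: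
  assumes "\<And>i j. c i j = c j i"
  shows "inner u (weighted_laplacian c v) = inner (weighted_laplacian c u) v"
  unfolding inner_commute[of "weighted_laplacian c u"] inner_weighted_laplacian[of c, OF assms]
  by (simp add: mult_ac)

lemma dirichlet_energy_nonneg:
  assumes "\<And>i j. 0 \<le> c i j"
  shows "0 \<le> dirichlet_energy c v"
  unfolding dirichlet_energy_def by (intro sum_nonneg mult_nonneg_nonneg) (auto simp: assms)

text \<open>
  From \<open>(a - b)\<^sup>2 \<le> 2 a\<^sup>2 + 2 b\<^sup>2\<close>: by symmetry both halves give the same sum, and each is controlled
  by the row sums.
\<close>

lemma dirichlet_energy_le:
  assumes sym: "\<And>i j. c i j = c j i" and nonneg: "\<And>i j. 0 \<le> c i j"
    and row: "\<And>i. (\<Sum>j\<in>UNIV. c i j) \<le> 1"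
  shows "dirichlet_energy c v \<le> 4 * (norm v)\<^sup>2"
proof -
  define S where "S = (\<Sum>i\<in>UNIV. \<Sum>j\<in>UNIV. c i j * (v $ i)\<^sup>2)"
  have "S = (\<Sum>j\<in>UNIV. \<Sum>i\<in>UNIV. c i j * (v $ i)\<^sup>2)"
    unfolding S_def by (rule sum.swap)
  also have "\<dots> = (\<Sum>i\<in>UNIV. \<Sum>j\<in>UNIV. c i j * (v $ j)\<^sup>2)"
    by (intro sum.cong refl) (subst sym, simp)
  finally have S2: "S = (\<Sum>i\<in>UNIV. \<Sum>j\<in>UNIV. c i j * (v $ j)\<^sup>2)" .
  have "dirichlet_energy c v \<le> (\<Sum>i\<in>UNIV. \<Sum>j\<in>UNIV. c i j * (2 * (v $ i)\<^sup>2 + 2 * (v $ j)\<^sup>2))"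
    unfolding dirichlet_energy_def
  proof (intro sum_mono mult_left_mono nonneg)
    fix i j
    have "0 \<le> (v $ i + v $ j)\<^sup>2" by simp
    then show "(v $ i - v $ j)\<^sup>2 \<le> 2 * (v $ i)\<^sup>2 + 2 * (v $ j)\<^sup>2"
      unfolding power2_sum power2_diff by linarith
  qed
  also have "\<dots> = 2 * S + 2 * S"
    by (subst (2) S2) (simp add: S_def algebra_simps sum.distrib sum_distrib_left)
  also have "S \<le> (\<Sum>i\<in>UNIV. (v $ i)\<^sup>2)"
    unfolding S_def sum_distrib_right[symmetric]
    by (intro sum_mono mult_left_le_one_le row sum_nonneg nonneg) simp
  also have "\<dots> = (norm v)\<^sup>2"
    unfolding power2_norm_eq_inner by (simp add: inner_vec_def power2_eq_square)
  finally show ?thesis by simp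
qed

text \<open>
  For \<open>0 \<le> L \<le> 1\<close> this says \<open>L\<^sup>2 \<le> L\<close>. It follows from expanding
  \<open>0 \<le> \<langle>v - L v, L (v - L v)\<rangle>\<close> and bounding the term \<open>\<langle>L v, L (L v)\<rangle>\<close> by \<open>\<parallel>L v\<parallel>\<^sup>2\<close>.
\<close>

lemma norm_weighted_laplacian_le:
  assumes sym: "\<And>i j. c i j = c j i" and nonneg: "\<And>i j. 0 \<le> c i j"
    and row: "\<And>i. (\<Sum>j\<in>UNIV. c i j) \<le> 1"
  shows "(norm (weighted_laplacian c v))\<^sup>2 \<le> inner v (weighted_laplacian c v)"
proof -
  let ?L = "weighted_laplacian c"
  have "0 \<le> inner (v - ?L v) (?L (v - ?L v))"
    by (simp add: inner_weighted_laplacian_self[of c, OF sym] dirichlet_energy_nonneg nonneg)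
  also have "\<dots> = inner v (?L v) - 2 * (norm (?L v))\<^sup>2 + inner (?L v) (?L (?L v))"
    by (simp add: linear_diff[OF linear_weighted_laplacian] inner_simps power2_norm_eq_inner
        weighted_laplacian_self_adjoint[of c v "?L v", OF sym])
  also have "inner (?L v) (?L (?L v)) \<le> (norm (?L v))\<^sup>2"
    unfolding inner_weighted_laplacian_self[of c, OF sym]
    using dirichlet_energy_le[of c "?L v", OF sym nonneg row] by simp
  finally show ?thesis by simp
qed

definition centered :: "real ^ 'n::finite \<Rightarrow> real ^ 'n"
  where "centered v = v - ((\<Sum>j\<in>UNIV. v $ j) / CARD('n)) *\<^sub>R all_ones"

lemma norm_centered:
  fixes v :: "real ^ 'n::finite"
  shows "2 * real CARD('n) * (norm (centered v))\<^sup>2 = (\<Sum>i\<in>UNIV. \<Sum>j\<in>UNIV. (v $ i - v $ j)\<^sup>2)"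
proof -
  define s where "s = (\<Sum>j\<in>UNIV. v $ j)"
  define Q where "Q = (\<Sum>j\<in>UNIV. (v $ j)\<^sup>2)"
  have n: "real CARD('n) > 0" by simp
  have "(norm (centered v))\<^sup>2 = (\<Sum>i\<in>UNIV. (v $ i - s / CARD('n))\<^sup>2)"
    unfolding power2_norm_eq_inner
    by (simp add: inner_vec_def centered_def all_ones_def s_def power2_eq_square)
  also have "\<dots> = (\<Sum>i\<in>UNIV. (v $ i)\<^sup>2 - 2 * (s / CARD('n)) * v $ i + (s / CARD('n))\<^sup>2)"
    by (simp add: power2_diff algebra_simps)
  also have "\<dots> = Q - 2 * (s / CARD('n)) * s + CARD('n) * (s / CARD('n))\<^sup>2"
    by (simp only: sum.distrib sum_subtractf sum_distrib_left[symmetric] s_def[symmetric] Q_def[symmetric]) simp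
  also have "\<dots> = Q - s\<^sup>2 / CARD('n)"
    using n by (simp add: power2_eq_square)
  finally have l: "2 * real CARD('n) * (norm (centered v))\<^sup>2 = 2 * real CARD('n) * Q - 2 * s\<^sup>2"
    using n by (simp add: right_diff_distrib)
  have "(\<Sum>i\<in>UNIV. \<Sum>j\<in>UNIV. (v $ i - v $ j)\<^sup>2)
    = (\<Sum>i\<in>UNIV. \<Sum>j\<in>UNIV. (v $ i)\<^sup>2 + (v $ j)\<^sup>2 - 2 * (v $ i * v $ j))"
    by (simp add: power2_diff algebra_simps)
  also have "\<dots> = CARD('n) * Q + CARD('n) * Q - 2 * (s * s)"
    by (simp only: sum.distrib sum_subtractf sum_distrib_left[symmetric] sum_distrib_right[symmetric] sum_product[symmetric] s_def[symmetric] Q_def[symmetric])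
      (simp add: Q_def sum_distrib_left)
  finally show ?thesis using l by (simp add: power2_eq_square)
qed

text \<open>
  Turns a Poincare inequality on the zero-sum vectors into \<open>a L \<le> L\<^sup>2\<close> on the whole space; the
  constants cause no trouble because they lie in the kernel of \<open>L\<close>. By the Cauchy-Schwarz
  inequality \<open>\<langle>v, L v\<rangle>\<^sup>2 \<le> \<parallel>centered v\<parallel>\<^sup>2 \<parallel>L v\<parallel>\<^sup>2\<close>, and the first factor is at most
  \<open>\<langle>v, L v\<rangle> / a\<close>.
\<close>

lemma weighted_laplacian_spectral_gap:
  assumes sym: "\<And>i j. c i j = c j i"
    and gap: "\<And>v. a * (norm (centered v))\<^sup>2 \<le> inner v (weighted_laplacian c v)"
    and a: "0 \<le> a" 
  shows "a * inner v (weighted_laplacian c v) \<le> (norm (weighted_laplacian c v))\<^sup>2"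
proof -
  let ?L = "weighted_laplacian c"
  have "inner all_ones (?L v) = 0"
    by (simp add: weighted_laplacian_self_adjoint[of c, OF sym] weighted_laplacian_all_ones)
  then have "inner v (?L v) = inner (centered v) (?L v)"
    by (simp add: centered_def inner_simps)
  also have "\<dots> \<le> norm (centered v) * norm (?L v)"
    by (rule norm_cauchy_schwarz)
  finally have e: "inner v (?L v) \<le> norm (centered v) * norm (?L v)" .
  have nn: "0 \<le> inner v (?L v)" using gap[of v] a by (meson mult_nonneg_nonneg order_trans zero_le_power2)
  show ?thesis
  proof (cases "inner v (?L v) = 0")
    case False
    have "a * (inner v (?L v))\<^sup>2 \<le> a * (norm (centered v) * norm (?L v))\<^sup>2"
      using e nn a by (intro mult_left_mono power_mono) auto
    also have "\<dots> = (a * (norm (centered v))\<^sup>2) * (norm (?L v))\<^sup>2"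
      by (simp add: power_mult_distrib)
    also have "\<dots> \<le> inner v (?L v) * (norm (?L v))\<^sup>2"
      using gap by (intro mult_right_mono) auto
    finally show ?thesis using False nn by (simp add: power2_eq_square)
  qed simp
qed

text \<open>
  The gap makes the kernel of \<open>L\<close> consist of the constants only. Adding the rank-one map
  \<open>v \<mapsto> (sum of v) 1\<close> therefore makes \<open>L\<close> injective, hence surjective, and the correction
  vanishes on a preimage of a zero-sum vector.
\<close>

lemma weighted_laplacian_range:
  fixes y :: "real ^ 'n::finite"
  assumes sym: "\<And>i j. c i j = c j i"
    and gap: "\<And>v. a * (norm (centered v))\<^sup>2 \<le> inner v (weighted_laplacian c v)"
    and a: "0 < a"
    and zero_sum: "(\<Sum>j\<in>UNIV. y $ j) = 0"
  shows "\<exists>w. y = weighted_laplacian c w"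
proof -
  let ?L = "weighted_laplacian c"
  define A where "A = (\<lambda>v::real ^ 'n. ?L v + inner all_ones v *\<^sub>R all_ones)"
  have sum1: "inner all_ones v = (\<Sum>j\<in>UNIV. v $ j)" for v :: "real ^ 'n"
    by (simp add: inner_vec_def all_ones_def)
  have linA: "linear A"
    unfolding A_def
    by (intro linear_compose_add linear_weighted_laplacian linearI)
      (simp_all add: inner_simps algebra_simps)
  have "v = 0" if "A v = 0" for v
  proof -
    have "0 = inner v (A v)" using that by simp
    also have "\<dots> = inner v (?L v) + (inner all_ones v)\<^sup>2"
      by (simp add: A_def inner_simps power2_eq_square inner_commute)
    finally have eq: "inner v (?L v) + (inner all_ones v)\<^sup>2 = 0" by simp
    moreover have "0 \<le> inner v (?L v)"
      using gap[of v] a by (meson less_imp_le mult_nonneg_nonneg order_trans zero_le_power2)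
    ultimately have "inner all_ones v = 0" and "inner v (?L v) = 0"
      by (simp_all add: add_nonneg_eq_0_iff)
    then have "a * (norm (centered v))\<^sup>2 \<le> 0" "centered v = v"
      using gap[of v] by (simp_all add: centered_def sum1)
    then show "v = 0" using a by (simp add: mult_le_0_iff)
  qed
  then have "inj A" using linA by (simp add: linear_injective_0)
  then have "surj A" by (rule linear_inj_imp_surj[OF linA])
  then obtain w where w: "y = A w" by (rule surjE)
  have "0 = inner all_ones (A w)" using zero_sum w sum1 by simp
  also have "\<dots> = CARD('n) * inner all_ones w"
    by (simp add: A_def inner_simps weighted_laplacian_self_adjoint[of c, OF sym]
        weighted_laplacian_all_ones) (simp add: inner_vec_def all_ones_def)
  finally have "inner all_ones w = 0" by simp
  then show ?thesis using w by (auto simp: A_def)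
qed

section \<open>Degrees along a shortest walk\<close>

text \<open>
  Two vertices \<open>p l\<close> and \<open>p m\<close> of a shortest walk with a connection of length \<open>h\<close> between them satisfy
  \<open>m \<le> l + h\<close>, as the walk could be shortened otherwise. The case \<open>h = 2\<close>
  keeps the vertices adjacent to a common \<open>u\<close> close together, the case \<open>h = 0\<close> excludes repetitions.
\<close>

lemma shortest_walk:
  fixes R :: "'a rel"
  assumes "(i, j) \<in> R\<^sup>*"
  obtains p k where "p 0 = i" "p k = j" "\<And>l. l < k \<Longrightarrow> (p l, p (Suc l)) \<in> R"
    "\<And>l m u. \<lbrakk>l \<le> m; m \<le> k; (p l, u) \<in> R; (u, p m) \<in> R\<rbrakk> \<Longrightarrow> m \<le> l + 2"
    "inj_on p {..k}"
proof -
  define k where "k = (LEAST k. (i, j) \<in> R ^^ k)"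
  obtain m where m: "(i, j) \<in> R ^^ m" using rtrancl_imp_relpow[OF assms] by blast
  then have "(i, j) \<in> R ^^ k" unfolding k_def by (rule LeastI)
  then obtain p where p: "p 0 = i" "p k = j" and step: "\<And>l. l < k \<Longrightarrow> (p l, p (Suc l)) \<in> R"
    unfolding relpow_fun_conv by blast
  have minimal: "k \<le> m" if "(i, j) \<in> R ^^ m" for m
    unfolding k_def using that by (rule Least_le)
  have sub: "(p l, p m) \<in> R ^^ (m - l)" if "l \<le> m" "m \<le> k" for l m
    unfolding relpow_fun_conv
    by (intro exI[of _ "\<lambda>h. p (l + h)"]) (use that step in auto)
  have shortcut: "m \<le> l + h" if "l \<le> m" "m \<le> k" "(p l, p m) \<in> R ^^ h" for l m h
  proof -
    have "(i, j) \<in> R ^^ (l + h + (k - m))"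
      unfolding relpow_add using sub[of 0 l] sub[of m k] that p by auto
    from minimal[OF this] that show ?thesis by linarith
  qed
  show thesis
  proof
    show "m \<le> l + 2" if "l \<le> m" "m \<le> k" "(p l, u) \<in> R" "(u, p m) \<in> R" for l m u
      using shortcut[of l m 2] that by (auto simp: numeral_2_eq_2)
    have "l = m" if "p l = p m" "l \<le> m" "m \<le> k" for l m
      using shortcut[of l m 0] that by simp
    then show "inj_on p {..k}"
      by (intro inj_onI) (metis atMost_iff linorder_le_cases)
  qed (use p step in auto)
qed

text \<open>
  Double counting of the pairs of an index \<open>l\<close> and a neighbour \<open>u\<close> of \<open>p l\<close>: for fixed \<open>u\<close> the
  indices lie within distance 2 of each other, so there are at most three. A bound that used
  only the length of the walk and the maximal degree would be quadratic in the number of vertices.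
\<close>

lemma sum_degrees_shortest_walk:
  fixes R :: "'a::finite rel" and p :: "nat \<Rightarrow> 'a"
  assumes sym: "sym R"
    and short: "\<And>l m u. \<lbrakk>l \<le> m; m \<le> k; (p l, u) \<in> R; (u, p m) \<in> R\<rbrakk> \<Longrightarrow> m \<le> l + 2"
  shows "(\<Sum>l\<le>k. card (R `` {p l})) \<le> 3 * CARD('a)"
proof -
  have three: "card {l \<in> {..k}. (p l, u) \<in> R} \<le> 3" for u
  proof (cases "{l \<in> {..k}. (p l, u) \<in> R} = {}")
    case False
    define l where "l = Min {l \<in> {..k}. (p l, u) \<in> R}"
    have l: "l \<in> {l \<in> {..k}. (p l, u) \<in> R}"
      unfolding l_def by (rule Min_in) (use False in auto)
    have "l \<le> m" if "m \<in> {l \<in> {..k}. (p l, u) \<in> R}" for m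
      unfolding l_def by (rule Min_le) (use that in auto)
    then have "{l \<in> {..k}. (p l, u) \<in> R} \<subseteq> {l..l + 2}"
      using l short[of l _ u] sym by (auto dest: symD)
    from card_mono[OF _ this] show ?thesis by simp
  qed (simp only: card.empty)
  have "(\<Sum>l\<le>k. card (R `` {p l})) = (\<Sum>l\<le>k. \<Sum>u\<in>{u. (p l, u) \<in> R}. 1::nat)"
    by (simp add: Image_singleton)
  also have "\<dots> = (\<Sum>u\<in>UNIV. \<Sum>l\<in>{l \<in> {..k}. (p l, u) \<in> R}. 1::nat)"
    using sum.swap_restrict[of "{..k}" "UNIV::'a set" "\<lambda>_ _. 1::nat" "\<lambda>l u. (p l, u) \<in> R"]
    by (simp only: finite_atMost finite mem_Collect_eq UNIV_I simp_thms)
  also have "\<dots> \<le> (\<Sum>u\<in>(UNIV::'a set). 3)"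
    by (intro sum_mono) (use three in simp)
  finally show ?thesis by simp
qed

section \<open>Metropolis weights\<close>

definition metropolis_weight :: "'n pair_pre_digraph \<Rightarrow> 'n \<Rightarrow> 'n \<Rightarrow> real"
  where "metropolis_weight G i j =
    (if j \<in> neighbors G i then 1 / real (max (node_degree G i) (node_degree G j)) else 0)"

lemma metropolis_weight_nonneg: "0 \<le> metropolis_weight G i j"
  by (simp add: metropolis_weight_def)

lemma metropolis_weight_sym:
  assumes "sym (parcs G)"
  shows "metropolis_weight G i j = metropolis_weight G j i"
  using assms by (auto simp: metropolis_weight_def neighbors_def max.commute dest: symD)

text \<open>
  Each of the \<open>d i\<close> nonzero weights in row \<open>i\<close> is at most \<open>1 / d i\<close>.
\<close>

lemma metropolis_weight_row_sum:
  fixes G :: "('n::finite) pair_pre_digraph"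
  shows "(\<Sum>j\<in>UNIV. metropolis_weight G i j) \<le> 1"
proof -
  have "(\<Sum>j\<in>UNIV. metropolis_weight G i j)
      = (\<Sum>j\<in>neighbors G i. 1 / real (max (node_degree G i) (node_degree G j)))"
    by (simp add: metropolis_weight_def sum.If_cases)
  also have "\<dots> \<le> (\<Sum>j\<in>neighbors G i. 1 / real (node_degree G i))"
  proof (intro sum_mono)
    fix j assume "j \<in> neighbors G i"
    then have "0 < node_degree G i" by (auto simp: node_degree_def card_gt_0_iff)
    then show "1 / real (max (node_degree G i) (node_degree G j)) \<le> 1 / real (node_degree G i)"
      by (intro divide_left_mono) auto
  qed
  also have "\<dots> \<le> 1" by (simp add: node_degree_def)
  finally show ?thesis .
qed

text \<open>
  Cauchy-Schwarz along a shortest walk, with the reciprocal weights \<open>max (d i) (d j)\<close> as edge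
  resistances: their sum is at most twice the sum of the degrees along the walk, and the
  distinct edges of the walk contribute at most the whole energy.
\<close>

lemma metropolis_pair_difference:
  fixes G :: "('n::finite) pair_pre_digraph"
  assumes sym: "sym (parcs G)" and conn: "(i, j) \<in> (parcs G)\<^sup>*"
  shows "(v $ i - v $ j)\<^sup>2 \<le> 6 * real CARD('n) * dirichlet_energy (metropolis_weight G) v"
proof -
  obtain p k where p: "p 0 = i" "p k = j"
    and step: "\<And>l. l < k \<Longrightarrow> (p l, p (Suc l)) \<in> parcs G"
    and short: "\<And>l m u. \<lbrakk>l \<le> m; m \<le> k; (p l, u) \<in> parcs G; (u, p m) \<in> parcs G\<rbrakk> \<Longrightarrow> m \<le> l + 2"
    and inj: "inj_on p {..k}"
    using shortest_walk[OF conn] by metis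
  define d where "d l = real (max (node_degree G (p l)) (node_degree G (p (Suc l))))" for l
  define D where "D l = v $ p (Suc l) - v $ p l" for l
  have dpos: "0 < d l" if "l < k" for l
  proof -
    have "p (Suc l) \<in> neighbors G (p l)" using step[OF that] by (simp add: neighbors_def)
    then have "0 < node_degree G (p l)" by (auto simp: node_degree_def card_gt_0_iff)
    then show ?thesis by (simp add: d_def)
  qed
  have "v $ j - v $ i = (\<Sum>l<k. D l)"
    unfolding D_def using sum_lessThan_telescope[of "\<lambda>l. v $ p l" k] p by simp
  also have "\<dots> = (\<Sum>l<k. sqrt (d l) * (D l / sqrt (d l)))"
    by (intro sum.cong refl) (use dpos in \<open>simp add: less_imp_neq[symmetric]\<close>)
  finally have "(v $ i - v $ j)\<^sup>2 = (\<Sum>l<k. sqrt (d l) * (D l / sqrt (d l)))\<^sup>2"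
    by (simp only: power2_commute[of "v $ i"])
  also have "\<dots> \<le> (\<Sum>l<k. (sqrt (d l))\<^sup>2) * (\<Sum>l<k. (D l / sqrt (d l))\<^sup>2)"
    by (rule Cauchy_Schwarz_ineq_sum)
  also have "\<dots> = (\<Sum>l<k. d l) * (\<Sum>l<k. (D l)\<^sup>2 / d l)"
    by (intro arg_cong2[of _ _ _ _ "(*)"] sum.cong refl)
      (use dpos in \<open>auto simp: power_divide less_imp_le\<close>)
  also have "\<dots> \<le> (6 * real CARD('n)) * dirichlet_energy (metropolis_weight G) v"
  proof (rule mult_mono)
    let ?deg = "\<lambda>l. real (node_degree G (p l))"
    have "(\<Sum>l<k. d l) \<le> (\<Sum>l<k. ?deg l) + (\<Sum>l<k. ?deg (Suc l))"
      unfolding sum.distrib[symmetric] by (intro sum_mono) (simp add: d_def)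
    also have "(\<Sum>l<k. ?deg l) \<le> (\<Sum>l\<le>k. ?deg l)"
      by (rule sum_mono2) auto
    also have "(\<Sum>l<k. ?deg (Suc l)) \<le> (\<Sum>l\<le>k. ?deg l)"
      unfolding sum.atMost_shift by simp
    also have "(\<Sum>l\<le>k. ?deg l) \<le> 3 * CARD('n)"
    proof -
      have "parcs G `` {u} = neighbors G u" for u by (auto simp: neighbors_def)
      then have "(\<Sum>l\<le>k. node_degree G (p l)) \<le> 3 * CARD('n)"
        using sum_degrees_shortest_walk[of "parcs G" k p, OF sym short] by (simp add: node_degree_def)
      then show ?thesis by (simp flip: of_nat_sum)
    qed
    finally show "(\<Sum>l<k. d l) \<le> 6 * real CARD('n)" by simp
    let ?g = "\<lambda>(a, b). metropolis_weight G a b * (v $ a - v $ b)\<^sup>2"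
    let ?e = "\<lambda>l. (p l, p (Suc l))"
    have "(\<Sum>l<k. (D l)\<^sup>2 / d l) = (\<Sum>l<k. ?g (?e l))"
      by (intro sum.cong refl)
        (use step in \<open>auto simp: metropolis_weight_def neighbors_def D_def d_def power2_commute\<close>)
    also have "\<dots> = sum ?g (?e ` {..<k})"
    proof (rule sum.reindex[symmetric, unfolded o_def])
      show "inj_on ?e {..<k}" by (rule inj_onI) (use inj in \<open>auto dest: inj_onD\<close>)
    qed
    also have "\<dots> \<le> sum ?g (UNIV \<times> UNIV)"
      by (rule sum_mono2) (auto simp: metropolis_weight_nonneg)
    also have "\<dots> = dirichlet_energy (metropolis_weight G) v"
      by (simp add: dirichlet_energy_def sum.cartesian_product)
    finally show "(\<Sum>l<k. (D l)\<^sup>2 / d l) \<le> dirichlet_energy (metropolis_weight G) v" .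
    show "0 \<le> (\<Sum>l<k. (D l)\<^sup>2 / d l)" by (intro sum_nonneg) (use dpos in \<open>auto simp: less_imp_le\<close>)
  qed simp
  finally show ?thesis by simp
qed

text \<open>
  Averages the previous bound over all pairs of vertices.
\<close>

lemma metropolis_spectral_gap:
  fixes G :: "('n::finite) pair_pre_digraph"
  assumes sym: "sym (parcs G)" and conn: "\<And>i j. (i, j) \<in> (parcs G)\<^sup>*"
  shows "(norm (centered v))\<^sup>2
    \<le> 12 * (real CARD('n))\<^sup>2 * inner v (weighted_laplacian (metropolis_weight G) v)"
proof -
  let ?n = "real CARD('n)"
  let ?E = "dirichlet_energy (metropolis_weight G) v"
  have "2 * ?n * (norm (centered v))\<^sup>2 = (\<Sum>i\<in>UNIV. \<Sum>j\<in>UNIV. (v $ i - v $ j)\<^sup>2)"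
    using norm_centered[of v] by simp
  also have "\<dots> \<le> (\<Sum>i\<in>(UNIV::'n set). \<Sum>j\<in>(UNIV::'n set). 6 * ?n * ?E)"
    by (intro sum_mono metropolis_pair_difference sym conn)
  also have "\<dots> = 2 * ?n * (3 * ?n\<^sup>2 * ?E)"
    by (simp add: power2_eq_square)
  finally have "(norm (centered v))\<^sup>2 \<le> 3 * ?n\<^sup>2 * ?E"
    by (rule mult_left_le_imp_le) simp
  then show ?thesis
    unfolding inner_weighted_laplacian_self[of "metropolis_weight G", OF metropolis_weight_sym[OF sym]]
    by (simp add: mult_ac)
qed

section \<open>Convergence of the consensus protocol\<close>

lemma connected_pair_graph_rtrancl:
  assumes G: "pair_graph G" and verts: "pverts G = UNIV"
    and conn: "Digraph_Component.connected (with_proj G)"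
  shows "(i, j) \<in> (parcs G)\<^sup>*"
proof -
  interpret pair_graph G by (rule G)
  have "i \<rightarrow>\<^sup>*\<^bsub>with_proj G\<^esub> j"
    using conn verts symmetric_connected_imp_strongly_connected[OF sym_arcs] unfolding strongly_connected_def by simp
  then show ?thesis unfolding reachable_def by (auto dest: rtrancl_on_rtranclI)
qed

theorem theorem2p1:
  fixes G :: "('n::finite) pair_pre_digraph"
    and U :: real
    and x y :: "nat \<Rightarrow> real ^ 'n"
  assumes "pair_graph G"
    and "pverts G = UNIV"
    and "Digraph_Component.connected (with_proj G)"
    and "U \<ge> real CARD('n)"
    and "y 1 = x 1"
    and "\<And>t i. t \<ge> 1 \<Longrightarrow>
      y (t + 1) $ i = x t $ i + 1 / 2 * (\<Sum>j\<in>neighbors G i.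
        (x t $ j - x t $ i) / real (max (node_degree G i) (node_degree G j)))"
    and "\<And>t i. t \<ge> 1 \<Longrightarrow>
      x (t + 1) $ i = y (t + 1) $ i + (1 - 2 / (9 * U + 1)) * (y (t + 1) $ i - y t $ i)"
  shows "\<forall>t\<ge>1. (norm (y t - initial_average x *\<^sub>R all_ones))\<^sup>2
    \<le> 2 * (1 - 1 / (9 * U)) ^ (t - 1) * (norm (y 1 - initial_average x *\<^sub>R all_ones))\<^sup>2"
proof (intro allI impI)
  fix t :: nat
  assume t: "1 \<le> t"
  interpret pair_graph G by (rule assms(1))
  define c where "c = metropolis_weight G"
  let ?L = "weighted_laplacian c"
  define q where "q = 1 / (9 * U)"
  define n where "n = real CARD('n)"
  define m where "m = initial_average x *\<^sub>R (all_ones :: real ^ 'n)"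
  \<comment> \<open>Centred sequences, with time shifted to start from 0.\<close>
  define X where "X k = x (Suc k) - m" for k
  define Y where "Y k = y (Suc k) - m" for k
  have n1: "1 \<le> n" by (simp add: n_def Suc_leI)
  have nU: "n \<le> U" using assms(4) by (simp add: n_def)
  have symR: "sym (parcs G)" using sym_arcs by (simp add: symmetric_def)
  have conn: "(i, j) \<in> (parcs G)\<^sup>*" for i j
    by (rule connected_pair_graph_rtrancl) fact+
  have sym: "c i j = c j i" for i j unfolding c_def by (rule metropolis_weight_sym[OF symR])
  have q: "0 < q" "q \<le> 1" using n1 nU by (auto simp: q_def)
  have gap: "q\<^sup>2 * (norm (centered v))\<^sup>2 \<le> inner v (?L v)" for v
  proof -
    have nn: "0 \<le> inner v (?L v)"
      unfolding inner_weighted_laplacian_self[of c, OF sym]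
      by (simp add: dirichlet_energy_nonneg c_def metropolis_weight_nonneg)
    have "(norm (centered v))\<^sup>2 \<le> 12 * n\<^sup>2 * inner v (?L v)"
      unfolding c_def n_def by (rule metropolis_spectral_gap[OF symR conn])
    \<comment> \<open>Here \<open>12 \<le> 81 = 9\<^sup>2\<close> is the slack in the choice of \<open>q\<close>.\<close>
    also have "\<dots> \<le> 81 * U\<^sup>2 * inner v (?L v)"
      using nn n1 nU by (intro mult_right_mono mult_mono power_mono) auto
    finally show ?thesis using n1 nU
      by (simp add: q_def power_divide power_mult_distrib field_simps)
  qed
  have Lm: "?L (z - m) = ?L z" for z
    by (simp add: m_def linear_diff[OF linear_weighted_laplacian]
        linear_scale[OF linear_weighted_laplacian] weighted_laplacian_all_ones)
  have Y_step: "Y (Suc k) = X k - ?L (X k)" for k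
  proof -
    have "y (Suc k + 1) = x (Suc k) - ?L (x (Suc k))"
      unfolding vec_eq_iff
    proof
      fix i
      have "(\<Sum>j\<in>UNIV. c i j * (x (Suc k) $ i - x (Suc k) $ j)) =
        - (\<Sum>j\<in>neighbors G i. (x (Suc k) $ j - x (Suc k) $ i) /
            real (max (node_degree G i) (node_degree G j)))"
        unfolding sum_negf[symmetric]
        by (rule sum.mono_neutral_cong_right)
          (auto simp: c_def metropolis_weight_def minus_divide_left)
      then show "y (Suc k + 1) $ i = (x (Suc k) - ?L (x (Suc k))) $ i"
        using assms(6)[of "Suc k" i] by (simp add: weighted_laplacian_def)
    qed
    then show ?thesis by (simp add: X_def Y_def Lm)
  qed
  have coeff: "1 - 2 / (9 * U + 1) = (1 - q) / (1 + q)"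
  proof -
    have U: "9 * U = 1 / q" by (simp add: q_def)
    show ?thesis unfolding U using q by (simp add: field_simps)
  qed
  have X_step: "X (Suc k) = Y (Suc k) + ((1 - q) / (1 + q)) *\<^sub>R (Y (Suc k) - Y k)" for k
    using assms(7)[of "Suc k"] unfolding coeff by (simp add: X_def Y_def vec_eq_iff)
  have "(\<Sum>j\<in>UNIV. Y 0 $ j) = 0"
    using assms(5) by (simp add: Y_def m_def initial_average_def all_ones_def sum_subtractf)
  then obtain w where w: "Y 0 = ?L w"
    using weighted_laplacian_range[of c "q\<^sup>2" "Y 0", OF sym gap] q by auto
  have "(norm (Y (t - 1)))\<^sup>2 \<le> 2 * (1 - q) ^ (t - 1) * (norm (Y 0))\<^sup>2"
  proof (rule accelerated_iteration_bound[where L = ?L and x = X and w = w])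
    show "linear ?L" by (rule linear_weighted_laplacian)
    show "inner u (?L v) = inner (?L u) v" for u v
      by (rule weighted_laplacian_self_adjoint[OF sym])
    show "(norm (?L v))\<^sup>2 \<le> inner v (?L v)" for v
      by (rule norm_weighted_laplacian_le[OF sym])
        (simp_all add: c_def metropolis_weight_nonneg metropolis_weight_row_sum)
    show "q\<^sup>2 * inner v (?L v) \<le> (norm (?L v))\<^sup>2" for v
      by (rule weighted_laplacian_spectral_gap[OF sym gap]) simp
    show "X 0 = Y 0" using assms(5) by (simp add: X_def Y_def)
  qed (use q w Y_step X_step in auto)
  then show "(norm (y t - initial_average x *\<^sub>R all_ones))\<^sup>2
    \<le> 2 * (1 - 1 / (9 * U)) ^ (t - 1) * (norm (y 1 - initial_average x *\<^sub>R all_ones))\<^sup>2"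
    using t by (simp add: Y_def m_def q_def)
qed

end
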